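(* There exists a pair $(K(s),h)$, where $K(s)=bs+a$ (with $a,b\in\mathbb{R}$) is a stabilizing PD controller and $h\ge 0$ is a (sufficiently large) constant time-headway satisfying $$h>\max_{\omega}\Big(\sqrt{K_R(j\omega)\,\big(2-\omega^2K_R(j\omega)\big)}+\omega K_J(j\omega)\Big),$$ with $K_R(j\omega)=\frac12\Big(\frac1{K(j\omega)}+\frac1{K(j\omega)^*}\Big)$, $K_J(j\omega)=\frac1{2j}\Big(\frac1{K(j\omega)}-\frac1{K(j\omega)^*}\Big)$ and the maximum running over all real $\omega$ for which the argument of the square root is positive, such that the vehicle chain with closed-loop dynamics $$e_1=\frac{1}{s^2+(1+hs)K(s)}\big(d_0-(1+hs)d_1\big),$$ $$e_i=\frac{K(s)}{s^2+(1+hs)K(s)}\,e_{i-1}+\frac{1}{s^2+(1+hs)K(s)}\big(d_{i-1}-(1+hs)d_i\big),\qquad i=2,\dots,N,$$ is $(L_2,\ell_2)$ string stable provided $d_0=0$; that is, when only disturbance vectors $d=(d_0,\dots,d_N)$ with $d_0=0$ are considered, for every $\epsilon>0$ there exists $\delta>0$ such that, for all $N=1,2,\dots$, $\Vert d(\cdot)\Vert_2<\delta$ implies $\Vert e(\cdot)\Vert_2<\epsilon$.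
   Context: Vehicle chain: $N+1$ vehicles with positions $x_0(t),\dots,x_N(t)\in\mathbb{R}$ (index $0$ is the leader) obey $\ddot x_i=u_i+d_i$, where $u_i$ is the acceleration control input and $d_i$ the disturbance input; $u_0=0$. With constant time-headway $h\ge0$ and constant $r_0>0$, the spacing errors are $e_i=x_{i-1}-x_i-h\dot x_i-r_0$, $i=1,\dots,N$. The controller is $u_i(s)=K(s)e_i(s)$, $i=1,\dots,N$, with the same linear (time-invariant) transfer function $K(s)$ for all vehicles, which yields the closed-loop equations displayed in the claim, written in the Laplace domain (with zero initial error conditions, so that $e$ is the response to the disturbance $d$). Standing assumption: $K(0)\ne0$ (no pole cancellation). "Stabilizing" means that the closed-loop system is stable, i.e. the closed-loop transfer functions have no poles in the closed right half plane. Notation: $j$ is the imaginary unit and $^*$ denotes complex conjugation. For a scalar signal, $\Vert v(\cdot)\Vert=\sqrt{\int_{-\infty}^{+\infty}|v(t)|^2dt}$. For the vector signals $d=(d_0,\dots,d_N)$ and $e=(e_1,\dots,e_N)$, $\Vert d(\cdot)\Vert_2=\sqrt{\sum_{i=0}^N\Vert d_i(\cdot)\Vert^2}$ and $\Vert e(\cdot)\Vert_2=\sqrt{\sum_{i=1}^N\Vert e_i(\cdot)\Vert^2}$. Definition ($(L_2,\ell_2)$ string stability): with the closed-loop dynamics, for every $\epsilon>0$ there exists $\delta>0$ such that $\Vert d(\cdot)\Vert_2<\delta$ implies $\Vert e(\cdot)\Vert_2<\epsilon$, uniformly for all $N=1,2,\dots$ (the same $\delta$ for all $N$). The class of admissible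 disturbances may be restricted, here by $d_0=0$. *)

theory Defs
  imports "HOL-Complex_Analysis.Complex_Analysis"
begin

(* Signals are real functions on the whole time axis. The experiment starts at time 0 from zero
   initial conditions, so signals vanish on the negative half-line and the one-sided Laplace
   transform describes them completely. *)

definition causal :: "(real \<Rightarrow> real) \<Rightarrow> bool" where
  "causal v \<longleftrightarrow> (\<forall>t<0. v t = 0)"

definition square_integrable :: "(real \<Rightarrow> real) \<Rightarrow> bool" where
  "square_integrable v \<longleftrightarrow> v \<in> borel_measurable lborel \<and> integrable lborel (\<lambda>t. \<bar>v t\<bar>\<^sup>2)"

(* Meaningful for square integrable signals only: a divergent integral has the value 0. *)
definition signal_norm :: "(real \<Rightarrow> real) \<Rightarrow> real" where
  "signal_norm v = sqrt (LINT t|lborel. \<bar>v t\<bar>\<^sup>2)"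

(* L2_set f A is the square root of the sum of the squares of f over A. *)
definition vector_norm :: "nat set \<Rightarrow> (nat \<Rightarrow> real \<Rightarrow> real) \<Rightarrow> real" where
  "vector_norm I v = L2_set (\<lambda>i. signal_norm (v i)) I"

definition laplace_transformable :: "real \<Rightarrow> (real \<Rightarrow> real) \<Rightarrow> bool" where
  "laplace_transformable \<sigma> v \<longleftrightarrow> set_integrable lborel {0..} (\<lambda>t. exp (- \<sigma> * t) * v t)"

definition laplace :: "(real \<Rightarrow> real) \<Rightarrow> complex \<Rightarrow> complex" where
  "laplace v s = (LINT t:{0..}|lborel. exp (- s * of_real t) * of_real (v t))"

definition pd_controller :: "real \<Rightarrow> real \<Rightarrow> complex \<Rightarrow> complex" where
  "pd_controller a b s = of_real b * s + of_real a"

definition error_tf :: "(complex \<Rightarrow> complex) \<Rightarrow> real \<Rightarrow> complex \<Rightarrow> complex" where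
  "error_tf K h s = K s / (s\<^sup>2 + (1 + of_real h * s) * K s)"

definition disturbance_tf :: "(complex \<Rightarrow> complex) \<Rightarrow> real \<Rightarrow> complex \<Rightarrow> complex" where
  "disturbance_tf K h s = 1 / (s\<^sup>2 + (1 + of_real h * s) * K s)"

definition stabilizing :: "(complex \<Rightarrow> complex) \<Rightarrow> real \<Rightarrow> bool" where
  "stabilizing K h \<longleftrightarrow>
     (\<forall>s. Re s \<ge> 0 \<longrightarrow>
        \<not> is_pole (error_tf K h) s \<and>
        \<not> is_pole (disturbance_tf K h) s \<and>
        \<not> is_pole (\<lambda>s. disturbance_tf K h s * (1 + of_real h * s)) s)"

(* e 1, ..., e N is the response of the chain to d 0, ..., d N, with zero initial conditions. The
   equations are required on some half-plane of convergence, which may be taken as far to the right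
   as desired, in particular to the right of all poles of the transfer functions. *)
definition chain_response ::
  "(complex \<Rightarrow> complex) \<Rightarrow> real \<Rightarrow> nat \<Rightarrow> (nat \<Rightarrow> real \<Rightarrow> real) \<Rightarrow> (nat \<Rightarrow> real \<Rightarrow> real) \<Rightarrow> bool" where
  "chain_response K h N d e \<longleftrightarrow>
     (\<forall>i\<in>{0..N}. causal (d i)) \<and> (\<forall>i\<in>{1..N}. causal (e i)) \<and>
     (\<exists>\<sigma>. (\<forall>i\<in>{0..N}. laplace_transformable \<sigma> (d i)) \<and>
          (\<forall>i\<in>{1..N}. laplace_transformable \<sigma> (e i)) \<and>
          (\<forall>s. Re s > \<sigma> \<longrightarrow>
             laplace (e 1) s =
               disturbance_tf K h s * (laplace (d 0) s - (1 + of_real h * s) * laplace (d 1) s) \<and>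
             (\<forall>i\<in>{2..N}. laplace (e i) s =
               error_tf K h s * laplace (e (i - 1)) s +
               disturbance_tf K h s *
                 (laplace (d (i - 1)) s - (1 + of_real h * s) * laplace (d i) s))))"

(* String stability with respect to the class D of admissible disturbances. *)
definition L2_string_stable ::
  "(complex \<Rightarrow> complex) \<Rightarrow> real \<Rightarrow> ((nat \<Rightarrow> real \<Rightarrow> real) \<Rightarrow> bool) \<Rightarrow> bool" where
  "L2_string_stable K h D \<longleftrightarrow>
     (\<forall>\<epsilon>>0. \<exists>\<delta>>0. \<forall>N\<ge>1. \<forall>d e.
        D d \<and> (\<forall>i\<in>{0..N}. square_integrable (d i)) \<and> chain_response K h N d e \<and>
        vector_norm {0..N} d < \<delta> \<longrightarrow>
        (\<forall>i\<in>{1..N}. square_integrable (e i)) \<and> vector_norm {1..N} e < \<epsilon>)"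

(* The complex expressions below are real; Re only changes the type. *)
definition K_R :: "(complex \<Rightarrow> complex) \<Rightarrow> real \<Rightarrow> real" where
  "K_R K \<omega> = Re (1 / 2 * (1 / K (\<i> * of_real \<omega>) + 1 / cnj (K (\<i> * of_real \<omega>))))"

definition K_J :: "(complex \<Rightarrow> complex) \<Rightarrow> real \<Rightarrow> real" where
  "K_J K \<omega> = Re (1 / (2 * \<i>) * (1 / K (\<i> * of_real \<omega>) - 1 / cnj (K (\<i> * of_real \<omega>))))"

definition headway_radicand :: "(complex \<Rightarrow> complex) \<Rightarrow> real \<Rightarrow> real" where
  "headway_radicand K \<omega> = K_R K \<omega> * (2 - \<omega>\<^sup>2 * K_R K \<omega>)"

definition headway_function :: "(complex \<Rightarrow> complex) \<Rightarrow> real \<Rightarrow> real" where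
  "headway_function K \<omega> = sqrt (headway_radicand K \<omega>) + \<omega> * K_J K \<omega>"

(* h exceeds the maximum, which is attained at some maximizer. *)
definition exceeds_headway_bound :: "(complex \<Rightarrow> complex) \<Rightarrow> real \<Rightarrow> bool" where
  "exceeds_headway_bound K h \<longleftrightarrow>
     (\<exists>\<omega>\<^sub>0. is_arg_max (headway_function K) (\<lambda>\<omega>. headway_radicand K \<omega> > 0) \<omega>\<^sub>0 \<and>
           h > headway_function K \<omega>\<^sub>0)"

end

theory Submission
  imports Defs "HOL-Probability.Levy" "HOL-Real_Asymp.Real_Asymp"
begin

text \<open>
A witness is the constant gain \<open>K = 1\<close> with the headway \<open>h = 2\<close>: the closed-loop denominator is
\<open>s\<^sup>2 + (1 + 2 * s) = (s + 1)\<^sup>2\<close>, so the loop is stable, and the bound on the headway is \<open>sqrt 2\<close>.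

The difficulty is uniformity in \<open>N\<close>. From one vehicle to the next the error passes through
\<open>1 / (s + 1)\<^sup>2\<close>, whose gain reaches \<open>1\<close> at frequency zero, so bounding the vehicles one after another
gives constants that grow with the length of the chain. Instead an energy balance treats the
whole chain at once, in the time domain. Let \<open>p\<^sub>i\<close> be the displacement of vehicle \<open>i\<close> caused by the
disturbance and \<open>v\<^sub>i\<close>, \<open>a\<^sub>i\<close> its derivatives. Then \<open>a\<^sub>i = e\<^sub>i + d\<^sub>i\<close> and
\<open>e\<^sub>i = p\<^sub>i\<^sub>-\<^sub>1 - p\<^sub>i - 2 * v\<^sub>i\<close>, and an algebraic identity (lemma \<open>vehicle_energy_balance\<close>) shows that
\<open>d\<^sub>i\<^sup>2 - a\<^sub>i\<^sup>2\<close> is a square plus \<open>v\<^sub>i\<^sup>2 - v\<^sub>i\<^sub>-\<^sub>1\<^sup>2\<close> plus the derivative of a sum of squares. Integrated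
over \<open>{0..T}\<close> and summed over the vehicles, the velocity terms telescope (lemma
\<open>chain_energy_bound\<close>). Because \<open>d\<^sub>0 = 0\<close>, the leader has \<open>v\<^sub>0 = 0\<close>, and what remains is
\<open>\<Sum>i. \<integral> a\<^sub>i\<^sup>2 \<le> \<Sum>i. \<integral> d\<^sub>i\<^sup>2\<close> for every \<open>T\<close> and every \<open>N\<close>. Since \<open>e\<^sub>i = a\<^sub>i - d\<^sub>i\<close>, the chain has
gain at most \<open>2\<close> from \<open>d\<close> to \<open>e\<close> (lemma \<open>chain_L2_gain\<close>), and \<open>\<delta> = \<epsilon> / 2\<close> works.

Two points of analysis carry this over to the given setting. The response is specified by Laplace
transforms, and the equations of motion follow from them almost everywhere by injectivity of the
transform, which is derived from Levy's uniqueness theorem for characteristic functions. The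
disturbances are merely square integrable, so velocities are indefinite Lebesgue integrals that
need not be differentiable everywhere; the derivatives of squares in the energy balance are
therefore handled by Fubini's theorem (lemma \<open>power2_primitive\<close>).
\<close>

section \<open>Injectivity of the Laplace transform\<close>

text \<open>The positive and the negative part of \<open>g\<close> have the same Fourier transform. Its value at the origin
says that they have the same mass. If it is zero, both vanish. Otherwise both can be scaled to
probability densities; these have the same characteristic function, hence agree by Levy's uniqueness
theorem, and two parts that are never nonzero together can only agree by vanishing.\<close>
lemma fourier_zero_imp_AE_zero:
  fixes g :: "real \<Rightarrow> real"
  assumes g: "integrable lborel g"
    and zero: "\<And>x. (CLINT t|lborel. iexp (x * t) * complex_of_real (g t)) = 0"
  shows "AE t in lborel. g t = 0"
proof -
  define gp where "gp t = max (g t) 0" for t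
  define gm where "gm t = max (- g t) 0" for t
  have gm_int: "integrable lborel gm" and gp_int: "integrable lborel gp"
    unfolding gm_def gp_def using g by auto
  have [measurable]: "gp \<in> borel_measurable borel" "gm \<in> borel_measurable borel" "g \<in> borel_measurable borel"
    using gm_int gp_int g by (auto dest: borel_measurable_integrable)
  have g_eq: "g t = gp t - gm t" for t
    by (simp add: gp_def gm_def)
  have nn: "gp t \<ge> 0" "gm t \<ge> 0" for t by (simp_all add: gp_def gm_def)
  define c where "c = integral\<^sup>L lborel gp"
  have iexp_int: "integrable lborel (\<lambda>t. iexp (x * t) * complex_of_real (f t))"
    if "integrable lborel f" for f x
  proof (rule Bochner_Integration.integrable_bound[OF that])
    have [measurable]: "f \<in> borel_measurable borel"
      using that by (auto dest: borel_measurable_integrable)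
    show "(\<lambda>t. iexp (x * t) * complex_of_real (f t)) \<in> borel_measurable lborel" by measurable
  qed (simp add: norm_mult)
  have same: "(CLINT t|lborel. iexp (x * t) * complex_of_real (gp t)) =
      (CLINT t|lborel. iexp (x * t) * complex_of_real (gm t))" for x
    using zero[of x] iexp_int[OF gp_int, of x] iexp_int[OF gm_int, of x]
    by (simp add: g_eq of_real_diff ring_distribs)
  have "complex_of_real c = complex_of_real (integral\<^sup>L lborel gm)"
    using same[of 0] by (simp add: c_def integral_complex_of_real)
  then have c_gm: "integral\<^sup>L lborel gm = c"
    using of_real_eq_iff by metis
  have "c \<ge> 0"
    unfolding c_def by (simp add: nn)
  then consider "c = 0" | "c > 0" by linarith
  then show ?thesis
  proof cases
    case 1
    have "AE t in lborel. gp t = 0" "AE t in lborel. gm t = 0"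
      using integral_nonneg_eq_0_iff_AE[OF gp_int] integral_nonneg_eq_0_iff_AE[OF gm_int] 1 c_gm
      by (simp_all add: nn c_def)
    then show ?thesis
      by eventually_elim (simp add: g_eq)
  next
    case 2
    define M where "M f = density lborel (\<lambda>t. ennreal (f t / c))" for f :: "real \<Rightarrow> real"
    have prob: "real_distribution (M f)"
      if "integrable lborel f" "integral\<^sup>L lborel f = c" "\<And>t. f t \<ge> 0" for f
    proof -
      have [measurable]: "f \<in> borel_measurable borel"
        using that(1) by (auto dest: borel_measurable_integrable)
      have "emeasure (M f) (space (M f)) = (\<integral>\<^sup>+t. ennreal (f t / c) \<partial>lborel)"
        unfolding M_def by (simp add: emeasure_density)
      also have "\<dots> = ennreal (integral\<^sup>L lborel (\<lambda>t. f t / c))"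
        using that 2 by (intro nn_integral_eq_integral) auto
      also have "\<dots> = 1" using that 2 by simp
      finally have "prob_space (M f)" by (rule prob_spaceI)
      then show ?thesis
        unfolding real_distribution_def real_distribution_axioms_def by (simp add: M_def)
    qed
    have char_M: "char (M f) x = (CLINT t|lborel. iexp (x * t) * complex_of_real (f t)) / c"
      if "integrable lborel f" "\<And>t. f t \<ge> 0" for f x
    proof -
      have [measurable]: "f \<in> borel_measurable borel"
        using that(1) by (auto dest: borel_measurable_integrable)
      have "char (M f) x = (CLINT t|lborel. (f t / c) *\<^sub>R iexp (x * t))"
        unfolding char_def M_def using that 2
        by (subst integral_density) auto
      also have "\<dots> = (CLINT t|lborel. iexp (x * t) * complex_of_real (f t) / c)"
        by (simp add: scaleR_conv_of_real field_simps)
      finally show ?thesis by simp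
    qed
    have "char (M gp) = char (M gm)"
      using char_M[OF gp_int nn(1)] char_M[OF gm_int nn(2)] same by (simp add: fun_eq_iff)
    then have "M gp = M gm"
      using prob[OF gp_int] prob[OF gm_int] c_gm nn by (intro Levy_uniqueness) (auto simp: c_def)
    then have "AE t in lborel. ennreal (gp t / c) = ennreal (gm t / c)"
      unfolding M_def by (intro sigma_finite_measure.density_unique[OF sigma_finite_lborel]) auto
    then show ?thesis
    proof eventually_elim
      case (elim t)
      then have "gp t / c = gm t / c"
        using 2 nn by (subst (asm) ennreal_inj) auto
      then show ?case
        using 2 by (simp add: g_eq)
    qed
  qed
qed

text \<open>On a vertical line the Laplace transform of \<open>w\<close> is the Fourier transform of
\<open>exp (- \<sigma> * t) * w t\<close>, so one line suffices.\<close>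
lemma laplace_zero_imp_AE_zero:
  assumes w: "laplace_transformable \<sigma> w"
    and zero: "\<And>s. Re s = \<sigma> \<Longrightarrow> laplace w s = 0"
  shows "AE t in lborel. 0 \<le> t \<longrightarrow> w t = 0"
proof -
  define g where "g t = indicator {0..} t * (exp (- \<sigma> * t) * w t)" for t
  have "AE t in lborel. g t = 0"
  proof (rule fourier_zero_imp_AE_zero)
    show "integrable lborel g"
      using w unfolding laplace_transformable_def set_integrable_def g_def by simp
    fix x
    have "(CLINT t|lborel. iexp (x * t) * complex_of_real (g t)) = laplace w (Complex \<sigma> (- x))"
      unfolding laplace_def set_lebesgue_integral_def
    proof (rule Bochner_Integration.integral_cong)
      fix t
      have "iexp (x * t) * complex_of_real (exp (- \<sigma> * t)) = exp (- Complex \<sigma> (- x) * of_real t)"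
        unfolding exp_of_real[symmetric] exp_add[symmetric]
        by (rule arg_cong[of _ _ exp]) (simp add: complex_eq_iff)
      then show "iexp (x * t) * complex_of_real (g t) =
          indicat_real {0..} t *\<^sub>R (exp (- Complex \<sigma> (- x) * of_real t) * complex_of_real (w t))"
        by (simp add: g_def indicator_def)
    qed simp
    also have "\<dots> = 0" by (rule zero) simp
    finally show "(CLINT t|lborel. iexp (x * t) * complex_of_real (g t)) = 0" .
  qed
  then show ?thesis
    by eventually_elim (auto simp: g_def)
qed

section \<open>Primitives of locally integrable functions\<close>
definition primitive :: "(real \<Rightarrow> real) \<Rightarrow> real \<Rightarrow> real" where
  "primitive f t = (LINT \<tau>:{0..t}|lborel. f \<tau>)"

definition locally_integrable :: "(real \<Rightarrow> real) \<Rightarrow> bool" where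
  "locally_integrable f \<longleftrightarrow> f \<in> borel_measurable borel \<and> (\<forall>T. set_integrable lborel {0..T} f)"

lemma borel_measurable_primitive [measurable]:
  assumes [measurable]: "f \<in> borel_measurable borel"
  shows "primitive f \<in> borel_measurable borel"
proof -
  have "(\<lambda>t. LINT \<tau>|lborel. (if 0 \<le> \<tau> \<and> \<tau> \<le> t then f \<tau> else 0)) \<in> borel_measurable borel"
    by measurable
  moreover have "primitive f = (\<lambda>t. LINT \<tau>|lborel. (if 0 \<le> \<tau> \<and> \<tau> \<le> t then f \<tau> else 0))"
    unfolding primitive_def set_lebesgue_integral_def
    by (intro ext Bochner_Integration.integral_cong) (auto simp: indicator_def)
  ultimately show ?thesis by simp
qed

text \<open>Positions and velocities are primitives, and on a bounded horizon only their boundedness matters: it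
makes their products with a locally integrable function integrable.\<close>
lemma abs_primitive_le:
  assumes "locally_integrable f" "t \<le> T"
  shows "\<bar>primitive f t\<bar> \<le> (LINT \<tau>:{0..T}|lborel. \<bar>f \<tau>\<bar>)"
proof -
  have i: "set_integrable lborel {0..S} (\<lambda>\<tau>. \<bar>f \<tau>\<bar>)" for S
    using assms(1) by (intro set_integrable_abs) (auto simp: locally_integrable_def)
  have "\<bar>primitive f t\<bar> \<le> (LINT \<tau>|lborel. \<bar>indicat_real {0..t} \<tau> *\<^sub>R f \<tau>\<bar>)"
    unfolding primitive_def set_lebesgue_integral_def by (rule integral_abs_bound)
  also have "\<dots> \<le> (LINT \<tau>:{0..T}|lborel. \<bar>f \<tau>\<bar>)"
    unfolding set_lebesgue_integral_def
    using i[of T] i[of t] assms(2)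
    by (intro integral_mono) (auto simp: indicator_def set_integrable_def abs_mult)
  finally show ?thesis .
qed

lemma set_integrable_bounded_mult:
  fixes f g :: "real \<Rightarrow> real"
  assumes f: "set_integrable lborel {0..T} f" "f \<in> borel_measurable borel"
    and g: "g \<in> borel_measurable borel" "\<And>t. 0 \<le> t \<Longrightarrow> t \<le> T \<Longrightarrow> \<bar>g t\<bar> \<le> B"
  shows "set_integrable lborel {0..T} (\<lambda>t. g t * f t)"
proof (rule set_integrable_bound)
  show "set_integrable lborel {0..T} (\<lambda>t. B * f t)" using f by simp
  show "set_borel_measurable lborel {0..T} (\<lambda>t. g t * f t)"
    using f(2) g(1) unfolding set_borel_measurable_def by measurable
  show "AE t in lborel. t \<in> {0..T} \<longrightarrow> norm (g t * f t) \<le> norm (B * f t)"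
    using g(2) by (intro AE_I2) (fastforce simp: abs_mult intro!: mult_right_mono)
qed

lemma set_integrable_bounded:
  fixes g :: "real \<Rightarrow> real"
  assumes g: "g \<in> borel_measurable borel" "\<And>t. 0 \<le> t \<Longrightarrow> t \<le> T \<Longrightarrow> \<bar>g t\<bar> \<le> B"
  shows "set_integrable lborel {0..T} g"
proof -
  have "set_integrable lborel {0..T} (\<lambda>t. 1 :: real)"
    by (rule borel_integrable_atLeastAtMost') simp
  from set_integrable_bounded_mult[OF this _ g] show ?thesis by simp
qed

lemma locally_integrable_primitive:
  assumes "locally_integrable f"
  shows "locally_integrable (primitive f)"
  using assms abs_primitive_le[OF assms]
  by (auto simp: locally_integrable_def intro!: set_integrable_bounded)

lemma primitive_add:
  assumes "locally_integrable f" "locally_integrable g"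
  shows "primitive (\<lambda>t. f t + g t) t = primitive f t + primitive g t"
  using assms by (simp add: primitive_def locally_integrable_def)

lemma primitive_diff:
  assumes "locally_integrable f" "locally_integrable g"
  shows "primitive (\<lambda>t. f t - g t) t = primitive f t - primitive g t"
  using assms by (simp add: primitive_def locally_integrable_def)

text \<open>The derivative of \<open>(primitive f)\<^sup>2\<close> is \<open>2 * primitive f * f\<close>, but \<open>f\<close> is merely
integrable, so the fundamental theorem of calculus for continuous derivatives does not apply.
Instead the square is the integral of \<open>f x * f y\<close> over \<open>{0..T} \<times> {0..T}\<close>; the diagonal is a null
set, and Fubini's theorem evaluates the integral over each of the two triangles that it separates.\<close>
lemma power2_primitive:
  assumes f: "locally_integrable f"
  shows "(primitive f T)\<^sup>2 = (LINT t:{0..T}|lborel. 2 * (primitive f t * f t))"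
proof -
  define g where "g t = indicator {0..T} t * f t" for t
  have [measurable]: "f \<in> borel_measurable borel" using f by (simp add: locally_integrable_def)
  have [measurable]: "g \<in> borel_measurable borel" unfolding g_def by measurable
  have g: "integrable lborel g"
    using f by (simp add: locally_integrable_def set_integrable_def g_def[abs_def])
  define L where "L x y = (if y \<le> x then g x * g y else 0)" for x y
  have prod: "integrable (lborel \<Otimes>\<^sub>M lborel) (\<lambda>(x, y). g x * g y)"
    using g by (intro lborel_pair.Fubini_integrable) (auto simp: abs_mult split_beta')
  have L: "integrable (lborel \<Otimes>\<^sub>M lborel) (case_prod L)"
    by (rule Bochner_Integration.integrable_bound[OF prod]) (auto simp: L_def[abs_def])
  have prim: "(LINT y|lborel. L x y) = g x * primitive f x" for x
  proof -
    have "(LINT y|lborel. L x y) = (LINT y|lborel. g x * (indicator {0..x} y *\<^sub>R f y))"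
      by (intro Bochner_Integration.integral_cong) (auto simp: L_def g_def indicator_def)
    then show ?thesis by (simp add: primitive_def set_lebesgue_integral_def)
  qed
  have L_int: "integrable lborel (\<lambda>x. g x * primitive f x)"
    using lborel_pair.integrable_fst[OF L] by (simp add: prim)
  have "(primitive f T)\<^sup>2 = (LINT x|lborel. LINT y|lborel. g x * g y)"
    by (simp add: primitive_def set_lebesgue_integral_def g_def power2_eq_square)
  also have "\<dots> = (LINT x|lborel. (LINT y|lborel. L x y) + (LINT y|lborel. L y x))"
  proof (rule Bochner_Integration.integral_cong[OF refl])
    fix x
    have i: "integrable lborel (\<lambda>y. L x y)" "integrable lborel (\<lambda>y. L y x)"
      by (rule Bochner_Integration.integrable_bound[of _ "\<lambda>y. g x * g y"];
          use g in \<open>auto simp: L_def[abs_def] abs_mult\<close>)+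
    have "AE y in lborel. g x * g y = L x y + L y x"
      using AE_lborel_singleton[of x] by eventually_elim (auto simp: L_def)
    then have "(LINT y|lborel. g x * g y) = (LINT y|lborel. L x y + L y x)"
      by (intro integral_cong_AE) (auto simp: L_def[abs_def])
    with i show "(LINT y|lborel. g x * g y) = (LINT y|lborel. L x y) + (LINT y|lborel. L y x)"
      by simp
  qed
  also have "\<dots> = (LINT x|lborel. LINT y|lborel. L x y) + (LINT x|lborel. LINT y|lborel. L y x)"
    using lborel_pair.integrable_fst[OF L] lborel_pair.integrable_snd[OF L] by simp
  also have "(LINT x|lborel. LINT y|lborel. L y x) = (LINT x|lborel. LINT y|lborel. L x y)"
    by (rule lborel_pair.Fubini_integral[OF L])
  finally have "(primitive f T)\<^sup>2 = 2 * (LINT x|lborel. g x * primitive f x)"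
    by (simp add: prim)
  also have "\<dots> = (LINT t:{0..T}|lborel. 2 * (primitive f t * f t))"
    unfolding set_lebesgue_integral_def integral_mult_right_zero[symmetric]
    by (intro Bochner_Integration.integral_cong) (auto simp: g_def)
  finally show ?thesis .
qed

section \<open>Laplace transforms of linear combinations and primitives\<close>
lemma set_integrable_exp_decay:
  fixes s :: complex
  assumes "Re s > 0"
  shows "set_integrable lborel {a..} (\<lambda>t. exp (- s * of_real t))"
proof -
  have "set_integrable lborel {a..} (\<lambda>t. exp (- Re s * t))"
    unfolding set_integrable_def
  proof (rule integrableI_nonneg)
    have "(\<integral>\<^sup>+t. ennreal (indicat_real {a..} t *\<^sub>R exp (- Re s * t)) \<partial>lborel) =
        (\<integral>\<^sup>+t. ennreal (exp (- Re s * t)) * indicator {a..} t \<partial>lborel)"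
      by (intro nn_integral_cong) (auto simp: indicator_def)
    also have "\<dots> = ennreal (0 - (- exp (- Re s * a) / Re s))"
    proof (rule nn_integral_FTC_atLeast)
      show "((\<lambda>t. - exp (- Re s * t) / Re s) \<longlongrightarrow> 0) at_top"
        using assms by real_asymp
    qed (use assms in \<open>auto intro!: derivative_eq_intros\<close>)
    finally show "(\<integral>\<^sup>+t. ennreal (indicat_real {a..} t *\<^sub>R exp (- Re s * t)) \<partial>lborel) < \<infinity>"
      by simp
  qed auto
  then show ?thesis
    by (rule set_integrable_bound) (auto simp: set_borel_measurable_def)
qed

lemma set_integral_exp_decay:
  fixes s :: complex
  assumes s: "Re s > 0"
  shows "(LINT t:{a..}|lborel. exp (- s * of_real t)) = exp (- s * of_real a) / s"
proof -
  have [simp]: "s \<noteq> 0" using s by auto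
  define F where "F t = - exp (- s * of_real t) / s" for t :: real
  have "(LBINT t=ereal a..\<infinity>. exp (- s * of_real t)) = 0 - F a"
  proof (rule interval_integral_FTC_integrable)
    show "(F has_vector_derivative exp (- s * of_real t)) (at t)" for t
      unfolding F_def
      by (rule has_vector_derivative_real_field) (auto intro!: derivative_eq_intros)
    show "set_integrable lborel (einterval (ereal a) \<infinity>) (\<lambda>t. exp (- s * of_real t))"
      using set_integrable_exp_decay[OF s, of a] by (rule set_integrable_subset) auto
    have "(F \<longlongrightarrow> F a) (at_right a)"
      unfolding F_def by (intro tendsto_intros) auto
    then show "((F \<circ> real_of_ereal) \<longlongrightarrow> F a) (at_right (ereal a))"
      by (simp add: ereal_tendsto_simps)
    have "((\<lambda>t. norm (F t)) \<longlongrightarrow> 0) at_top"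
      unfolding F_def norm_divide norm_minus_cancel norm_exp_eq_Re using s by simp real_asymp
    then have "(F \<longlongrightarrow> 0) at_top"
      by (rule tendsto_norm_zero_cancel)
    then show "((F \<circ> real_of_ereal) \<longlongrightarrow> 0) (at_left \<infinity>)"
      by (simp add: ereal_tendsto_simps)
  qed auto
  also have "(LBINT t=ereal a..\<infinity>. exp (- s * of_real t)) = (LINT t:{a<..}|lborel. exp (- s * of_real t))"
    by (rule interval_integral_to_infinity_eq)
  also have "\<dots> = (LINT t:{a..}|lborel. exp (- s * of_real t))"
    unfolding set_lebesgue_integral_def
    using AE_lborel_singleton[of a]
    by (intro integral_cong_AE) (auto simp: indicator_def)
  finally show ?thesis by (simp add: F_def)
qed

lemma laplace_transformable_mono:
  assumes "laplace_transformable \<sigma> f" "\<sigma> \<le> \<rho>"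
  shows "laplace_transformable \<rho> f"
  unfolding laplace_transformable_def
proof (rule set_integrable_bound)
  have *: "set_integrable lborel {0..} (\<lambda>t. exp (- \<sigma> * t) * f t)"
    using assms unfolding laplace_transformable_def by simp
  then show "set_integrable lborel {0..} (\<lambda>t. exp (- \<sigma> * t) * f t)" .
  have "(\<lambda>t. indicator {0..} t *\<^sub>R (exp (- \<rho> * t) * f t)) =
      (\<lambda>t. exp ((\<sigma> - \<rho>) * t) * (indicator {0..} t *\<^sub>R (exp (- \<sigma> * t) * f t)))"
    by (auto simp: fun_eq_iff mult_exp_exp algebra_simps)
  moreover have "\<dots> \<in> borel_measurable lborel"
    using * unfolding set_integrable_def by (intro borel_measurable_times) auto
  ultimately show "set_borel_measurable lborel {0..} (\<lambda>t. exp (- \<rho> * t) * f t)"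
    unfolding set_borel_measurable_def by simp
  show "AE t in lborel. t \<in> {0..} \<longrightarrow> norm (exp (- \<rho> * t) * f t) \<le> norm (exp (- \<sigma> * t) * f t)"
    using assms(2) by (auto simp: abs_mult intro!: mult_right_mono)
qed

lemma set_integrable_laplace:
  assumes "laplace_transformable \<sigma> f" "Re s \<ge> \<sigma>"
  shows "set_integrable lborel {0..} (\<lambda>t. exp (- s * of_real t) * complex_of_real (f t))"
proof -
  define g where "g t = indicat_real {0..} t *\<^sub>R (exp (- Re s * t) * f t)" for t
  have g: "integrable lborel g"
    using laplace_transformable_mono[OF assms]
    unfolding laplace_transformable_def set_integrable_def g_def .
  have "integrable lborel (\<lambda>t. exp (- \<i> * Im s * t) * complex_of_real (g t))"
  proof (rule Bochner_Integration.integrable_bound[OF g])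
    have [measurable]: "g \<in> borel_measurable borel"
      using borel_measurable_integrable[OF g] by simp
    show "(\<lambda>t. exp (- \<i> * Im s * t) * complex_of_real (g t)) \<in> borel_measurable lborel"
      by measurable
  qed (simp add: norm_mult)
  moreover have "exp (- \<i> * Im s * t) * complex_of_real (g t) =
      indicat_real {0..} t *\<^sub>R (exp (- s * of_real t) * complex_of_real (f t))" for t
  proof -
    have "exp (- s * of_real t) = exp (- \<i> * Im s * t) * complex_of_real (exp (- Re s * t))"
      unfolding exp_of_real[symmetric] exp_add[symmetric]
      by (rule arg_cong[of _ _ exp]) (simp add: complex_eq_iff)
    then show ?thesis by (simp add: g_def indicator_def)
  qed
  ultimately show ?thesis
    unfolding set_integrable_def by simp
qed

lemma laplace_transformable_lincomb:
  assumes "laplace_transformable \<sigma> f" "laplace_transformable \<sigma> g"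
  shows "laplace_transformable \<sigma> (\<lambda>t. f t + c * g t)"
proof -
  have "set_integrable lborel {0..} (\<lambda>t. exp (- \<sigma> * t) * f t + c * (exp (- \<sigma> * t) * g t))"
    using assms unfolding laplace_transformable_def by simp
  then show ?thesis
    unfolding laplace_transformable_def by (simp add: algebra_simps)
qed

lemma laplace_lincomb:
  assumes "laplace_transformable \<sigma> f" "laplace_transformable \<sigma> g" "Re s \<ge> \<sigma>"
  shows "laplace (\<lambda>t. f t + c * g t) s = laplace f s + of_real c * laplace g s"
proof -
  have "laplace (\<lambda>t. f t + c * g t) s = (LINT t:{0..}|lborel.
      exp (- s * of_real t) * of_real (f t) + of_real c * (exp (- s * of_real t) * of_real (g t)))"
    unfolding laplace_def by (simp add: algebra_simps)
  also have "\<dots> = laplace f s + of_real c * laplace g s"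
    using assms set_integrable_laplace unfolding laplace_def by (subst set_integral_add) auto
  finally show ?thesis .
qed

lemma laplace_transformable_imp_locally_integrable:
  assumes f: "laplace_transformable \<sigma> f" "f \<in> borel_measurable borel"
  shows "locally_integrable f"
  unfolding locally_integrable_def
proof (intro conjI allI f(2))
  fix T
  have "set_integrable lborel {0..T} (\<lambda>t. exp (- \<sigma> * t) * f t)"
    using f(1) unfolding laplace_transformable_def by (rule set_integrable_subset) auto
  then have "set_integrable lborel {0..T} (\<lambda>t. exp (\<sigma> * t) * (exp (- \<sigma> * t) * f t))"
  proof (rule set_integrable_bounded_mult)
    show "\<bar>exp (\<sigma> * t)\<bar> \<le> exp (\<bar>\<sigma>\<bar> * T)" if "0 \<le> t" "t \<le> T" for t
    proof -
      have "\<sigma> * t \<le> \<bar>\<sigma>\<bar> * t" using that by (intro mult_right_mono) auto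
      also have "\<dots> \<le> \<bar>\<sigma>\<bar> * T" using that by (intro mult_left_mono) auto
      finally show ?thesis by simp
    qed
  qed (use f(2) in measurable)
  then show "set_integrable lborel {0..T} f"
    by (simp add: mult.assoc[symmetric] mult_exp_exp)
qed

text \<open>Transformability restricts a signal on the half-line only; causality supplies the rest.\<close>
lemma causal_transformable_measurable:
  assumes "laplace_transformable \<sigma> f" "causal f"
  shows "f \<in> borel_measurable borel"
proof -
  have "(\<lambda>t. exp (\<sigma> * t) * (indicator {0..} t *\<^sub>R (exp (- \<sigma> * t) * f t))) \<in> borel_measurable lborel"
    using assms unfolding laplace_transformable_def set_integrable_def
    by (intro borel_measurable_times) auto
  moreover have "(\<lambda>t. exp (\<sigma> * t) * (indicator {0..} t *\<^sub>R (exp (- \<sigma> * t) * f t))) = f"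
    using assms(2) by (auto simp: causal_def indicator_def mult.assoc[symmetric] mult_exp_exp)
  ultimately show ?thesis by simp
qed

text \<open>Integration in time is division by \<open>s\<close>: interchange the integrals of
\<open>exp (- s * t) * f \<tau>\<close> over the wedge \<open>0 \<le> \<tau> \<le> t\<close>.\<close>
lemma laplace_primitive:
  assumes f: "laplace_transformable \<sigma> f" "f \<in> borel_measurable borel"
    and s: "Re s \<ge> \<sigma>" "Re s > 0"
  shows "laplace_transformable (Re s) (primitive f)"
    and "laplace (primitive f) s = laplace f s / s"
proof -
  define \<phi> where "\<phi> z \<tau> t = (if 0 \<le> \<tau> \<and> \<tau> \<le> t then exp (- z * of_real t) * complex_of_real (f \<tau>) else 0)"
    for z \<tau> t
  have [measurable]: "f \<in> borel_measurable borel" by fact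
  have inner_t: "(LINT t|lborel. \<phi> z \<tau> t) =
      indicat_real {0..} \<tau> *\<^sub>R (exp (- z * of_real \<tau>) * of_real (f \<tau>)) / z"
    if "Re z > 0" for z \<tau>
  proof -
    have "(LINT t|lborel. \<phi> z \<tau> t) =
        (LINT t|lborel. (indicat_real {0..} \<tau> * f \<tau>) *\<^sub>R (indicat_real {\<tau>..} t *\<^sub>R exp (- z * of_real t)))"
      by (intro Bochner_Integration.integral_cong) (auto simp: \<phi>_def indicator_def scaleR_conv_of_real)
    also have "\<dots> = (indicat_real {0..} \<tau> * f \<tau>) *\<^sub>R (exp (- z * of_real \<tau>) / z)"
      using set_integral_exp_decay[OF that, of \<tau>]
      unfolding set_lebesgue_integral_def by (simp only: integral_scaleR_right)
    finally show ?thesis by (simp add: scaleR_conv_of_real)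
  qed
  have inner_\<tau>: "(LINT \<tau>|lborel. \<phi> z \<tau> t) =
      indicat_real {0..} t *\<^sub>R (exp (- z * of_real t) * of_real (primitive f t))" for z t
  proof -
    have "(LINT \<tau>|lborel. \<phi> z \<tau> t) = (LINT \<tau>|lborel. (indicat_real {0..} t *\<^sub>R exp (- z * of_real t)) *
        complex_of_real (indicat_real {0..t} \<tau> *\<^sub>R f \<tau>))"
      by (intro Bochner_Integration.integral_cong) (auto simp: \<phi>_def indicator_def)
    also have "\<dots> = (indicat_real {0..} t *\<^sub>R exp (- z * of_real t)) * complex_of_real (primitive f t)"
      unfolding primitive_def set_lebesgue_integral_def integral_complex_of_real[symmetric]
      by (rule integral_mult_right_zero)
    finally show ?thesis by simp
  qed
  have \<phi>_int: "integrable (lborel \<Otimes>\<^sub>M lborel) (case_prod (\<phi> z))" if z: "Re z \<ge> \<sigma>" "Re z > 0" for z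
  proof (rule lborel_pair.Fubini_integrable)
    show "case_prod (\<phi> z) \<in> borel_measurable (lborel \<Otimes>\<^sub>M lborel)"
      unfolding \<phi>_def by measurable
    have norm_\<phi>: "norm (\<phi> z \<tau> t) = norm (\<phi> (of_real (Re z)) \<tau> t)" for \<tau> t
      by (simp add: \<phi>_def norm_mult norm_exp_eq_Re)
    \<comment> \<open>On the real axis the absolute value of the integrand differs from it by a sign that depends on \<open>\<tau>\<close> only, so the integral over \<open>t\<close> is already known.\<close>
    have re: "complex_of_real (norm (\<phi> (of_real (Re z)) \<tau> t)) =
        (if f \<tau> \<ge> 0 then 1 else -1) * \<phi> (of_real (Re z)) \<tau> t" for \<tau> t
      by (simp add: \<phi>_def norm_mult norm_exp_eq_Re exp_of_real[symmetric])
    have "complex_of_real (LINT t|lborel. norm (\<phi> z \<tau> t)) =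
        (if f \<tau> \<ge> 0 then 1 else -1) * (LINT t|lborel. \<phi> (of_real (Re z)) \<tau> t)" for \<tau>
      unfolding norm_\<phi> integral_complex_of_real[symmetric] re by (rule integral_mult_right_zero)
    also have "(if f \<tau> \<ge> 0 then 1 else -1) * (LINT t|lborel. \<phi> (of_real (Re z)) \<tau> t) =
        complex_of_real (indicat_real {0..} \<tau> *\<^sub>R \<bar>exp (- Re z * \<tau>) * f \<tau>\<bar> / Re z)" for \<tau>
      using z(2) by (simp add: inner_t abs_mult exp_of_real[symmetric] indicator_def)
    finally have eq: "(LINT t|lborel. norm (\<phi> z \<tau> t)) =
        indicat_real {0..} \<tau> *\<^sub>R \<bar>exp (- Re z * \<tau>) * f \<tau>\<bar> / Re z" for \<tau>
      using of_real_eq_iff by blast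
    have "set_integrable lborel {0..} (\<lambda>t. \<bar>exp (- Re z * t) * f t\<bar>)"
      using laplace_transformable_mono[OF f(1) z(1)] unfolding laplace_transformable_def
      by (rule set_integrable_abs)
    then show "integrable lborel (\<lambda>\<tau>. LINT t|lborel. norm (case_prod (\<phi> z) (\<tau>, t)))"
      unfolding set_integrable_def case_prod_conv eq by (rule integrable_divide)
    show "AE \<tau> in lborel. integrable lborel (\<lambda>t. case_prod (\<phi> z) (\<tau>, t))"
    proof (rule AE_I2)
      fix \<tau>
      have "integrable lborel (\<lambda>t. (indicat_real {0..} \<tau> * f \<tau>) *\<^sub>R (indicat_real {\<tau>..} t *\<^sub>R exp (- z * of_real t)))"
        using set_integrable_exp_decay[OF z(2), of \<tau>] unfolding set_integrable_def
        by (rule integrable_scaleR_right)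
      also have "(\<lambda>t. (indicat_real {0..} \<tau> * f \<tau>) *\<^sub>R (indicat_real {\<tau>..} t *\<^sub>R exp (- z * of_real t))) = \<phi> z \<tau>"
        by (auto simp: fun_eq_iff \<phi>_def indicator_def scaleR_conv_of_real)
      finally show "integrable lborel (\<lambda>t. case_prod (\<phi> z) (\<tau>, t))" by simp
    qed
  qed
  have "integrable lborel (\<lambda>t. LINT \<tau>|lborel. \<phi> (of_real (Re s)) \<tau> t)"
    using lborel_pair.integrable_snd[OF \<phi>_int[of "of_real (Re s)"]] s by simp
  then have "integrable lborel (\<lambda>t. complex_of_real (indicat_real {0..} t *\<^sub>R (exp (- Re s * t) * primitive f t)))"
    unfolding inner_\<tau> by (simp add: scaleR_conv_of_real exp_of_real[symmetric])
  then show "laplace_transformable (Re s) (primitive f)"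
    unfolding laplace_transformable_def set_integrable_def complex_of_real_integrable_eq .
  have "laplace (primitive f) s = (LINT t|lborel. LINT \<tau>|lborel. \<phi> s \<tau> t)"
    unfolding inner_\<tau> laplace_def set_lebesgue_integral_def ..
  also have "\<dots> = (LINT \<tau>|lborel. LINT t|lborel. \<phi> s \<tau> t)"
    by (rule lborel_pair.Fubini_integral[OF \<phi>_int[OF s]])
  also have "\<dots> = laplace f s / s"
    unfolding inner_t[OF s(2)] laplace_def set_lebesgue_integral_def
    by (rule integral_divide_zero)
  finally show "laplace (primitive f) s = laplace f s / s" .
qed

section \<open>The energy balance of the chain\<close>

text \<open>Write \<open>v\<close>, \<open>p\<close> and \<open>v'\<close>, \<open>p'\<close> for the velocity and the position of a vehicle and of its
predecessor, \<open>D = p - p'\<close> and \<open>w = D + v + v'\<close>. The equation of motion is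
\<open>d = a + 2 * v + D\<close>, and expanding the square gives
\<open>d\<^sup>2 = a\<^sup>2 + w\<^sup>2 + v\<^sup>2 - v'\<^sup>2 + 2 * v * a + 2 * (v + D) * (a + v - v')\<close>.
The last two terms are the derivative of \<open>v\<^sup>2 + (v + D)\<^sup>2\<close>, which starts at \<open>0\<close> and is
never negative, so that over a horizon \<open>T\<close> only \<open>v\<^sup>2 - v'\<^sup>2\<close> is left next to \<open>a\<^sup>2\<close>.

The remainder \<open>w\<^sup>2\<close> comes from the frequency domain: if \<open>z\<close> of modulus 1 stands for the shift
to the predecessor, then
\<open>\<bar>(1 + \<i> * \<omega>)\<^sup>2 - z\<bar>\<^sup>2 - \<omega>\<^sup>4 = \<bar>(1 - z) + \<i> * \<omega> * (1 + z)\<bar>\<^sup>2\<close>.\<close>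
lemma vehicle_energy_balance:
  assumes a: "locally_integrable a" and b: "locally_integrable b"
    and d: "d \<in> borel_measurable borel" "set_integrable lborel {0..T} (\<lambda>t. (d t)\<^sup>2)"
    and dyn: "AE t in lborel. 0 \<le> t \<longrightarrow>
      a t = d t + (primitive (primitive b) t - primitive (primitive a) t - 2 * primitive a t)"
  shows "set_integrable lborel {0..T} (\<lambda>t. (a t)\<^sup>2)"
    and "(LINT t:{0..T}|lborel. (a t)\<^sup>2) + (LINT t:{0..T}|lborel. (primitive a t)\<^sup>2)
      \<le> (LINT t:{0..T}|lborel. (d t)\<^sup>2) + (LINT t:{0..T}|lborel. (primitive b t)\<^sup>2)"
proof -
  define v where "v = primitive a"
  define v' where "v' = primitive b"
  define D where "D = primitive (\<lambda>t. v t - v' t)"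
  define g where "g t = a t + (v t - v' t)" for t
  define w where "w t = D t + v t + v' t" for t
  have li_diff: "locally_integrable (\<lambda>t. f t - h t)" if "locally_integrable f" "locally_integrable h" for f h
    using that by (auto simp: locally_integrable_def)
  have li_add: "locally_integrable (\<lambda>t. f t + h t)" if "locally_integrable f" "locally_integrable h" for f h
    using that by (auto simp: locally_integrable_def)
  have v: "locally_integrable v" and v': "locally_integrable v'"
    unfolding v_def v'_def using a b by (simp_all add: locally_integrable_primitive)
  have D: "locally_integrable D"
    unfolding D_def by (intro locally_integrable_primitive li_diff v v')
  have g: "locally_integrable g" and w: "locally_integrable w" and vD: "locally_integrable (\<lambda>t. v t + D t)"
    unfolding g_def w_def using a v v' D by (simp_all add: li_diff li_add)
  have [measurable]: "a \<in> borel_measurable borel" "v \<in> borel_measurable borel"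
    "v' \<in> borel_measurable borel" "D \<in> borel_measurable borel"
    using a v v' D by (simp_all add: locally_integrable_def)
  have [measurable]: "d \<in> borel_measurable borel" by fact
  obtain Bv where Bv: "\<And>t. t \<le> T \<Longrightarrow> \<bar>v t\<bar> \<le> Bv"
    using abs_primitive_le[OF a] unfolding v_def by blast
  obtain Bv' where Bv': "\<And>t. t \<le> T \<Longrightarrow> \<bar>v' t\<bar> \<le> Bv'"
    using abs_primitive_le[OF b] unfolding v'_def by blast
  obtain BD where BD: "\<And>t. t \<le> T \<Longrightarrow> \<bar>D t\<bar> \<le> BD"
    using abs_primitive_le[OF li_diff[OF v v']] unfolding D_def by blast
  have dyn': "AE t in lborel. 0 \<le> t \<longrightarrow> a t = d t - D t - 2 * v t"
    using dyn
  proof eventually_elim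
    case (elim t)
    have "D t = primitive v t - primitive v' t"
      unfolding D_def by (rule primitive_diff[OF v v'])
    with elim show ?case by (simp add: v_def v'_def)
  qed
  have bounded_mult: "set_integrable lborel {0..T} (\<lambda>t. f t * h t)"
    if "\<And>t. t \<le> T \<Longrightarrow> \<bar>f t\<bar> \<le> B" "locally_integrable f" "locally_integrable h" for f h B
    using that by (intro set_integrable_bounded_mult) (auto simp: locally_integrable_def)
  have v2: "set_integrable lborel {0..T} (\<lambda>t. (v t)\<^sup>2)"
    using bounded_mult[OF Bv v v] by (simp add: power2_eq_square)
  have v'2: "set_integrable lborel {0..T} (\<lambda>t. (v' t)\<^sup>2)"
    using bounded_mult[OF Bv' v' v'] by (simp add: power2_eq_square)
  have D2: "set_integrable lborel {0..T} (\<lambda>t. (D t)\<^sup>2)"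
    using bounded_mult[OF BD D D] by (simp add: power2_eq_square)
  have "\<bar>w t\<bar> \<le> BD + Bv + Bv'" if "t \<le> T" for t
    using Bv[OF that] Bv'[OF that] BD[OF that] unfolding w_def by linarith
  from bounded_mult[OF this w w] have w2: "set_integrable lborel {0..T} (\<lambda>t. (w t)\<^sup>2)"
    by (simp add: power2_eq_square)
  have va: "set_integrable lborel {0..T} (\<lambda>t. 2 * (v t * a t))"
    using bounded_mult[OF Bv v a] by simp
  have "\<bar>v t + D t\<bar> \<le> Bv + BD" if "t \<le> T" for t
    using Bv[OF that] BD[OF that] by linarith
  from bounded_mult[OF this vD g]
  have vDg: "set_integrable lborel {0..T} (\<lambda>t. 2 * ((v t + D t) * g t))"
    by simp
  show a2: "set_integrable lborel {0..T} (\<lambda>t. (a t)\<^sup>2)"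
  proof (rule set_integrable_bound)
    \<comment> \<open>By the Cauchy-Schwarz inequality \<open>(x + y + z)\<^sup>2 \<le> 3 * (x\<^sup>2 + y\<^sup>2 + z\<^sup>2)\<close>, with \<open>z = 2 * v\<close>.\<close>
    show "set_integrable lborel {0..T} (\<lambda>t. 3 * (d t)\<^sup>2 + 3 * (D t)\<^sup>2 + 12 * (v t)\<^sup>2)"
      using d(2) D2 v2 by simp
    show "AE t in lborel. t \<in> {0..T} \<longrightarrow>
        norm ((a t)\<^sup>2) \<le> norm (3 * (d t)\<^sup>2 + 3 * (D t)\<^sup>2 + 12 * (v t)\<^sup>2)"
      using dyn'
    proof eventually_elim
      case (elim t)
      have "(d t - D t - 2 * v t)\<^sup>2 \<le> 3 * (d t)\<^sup>2 + 3 * (D t)\<^sup>2 + 12 * (v t)\<^sup>2"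
        using zero_le_power2[of "d t + D t"] zero_le_power2[of "d t + 2 * v t"]
          zero_le_power2[of "D t - 2 * v t"]
        by (simp add: power2_eq_square algebra_simps)
      with elim show ?case by auto
    qed
  qed (simp add: set_borel_measurable_def)
  have [simp]: "primitive g t = v t + D t" for t
    unfolding g_def v_def[symmetric] D_def
    by (subst primitive_add[OF a li_diff[OF v v']]) (simp add: v_def)
  have "(LINT t:{0..T}|lborel. (d t)\<^sup>2) = (LINT t:{0..T}|lborel.
      (a t)\<^sup>2 + (w t)\<^sup>2 + (v t)\<^sup>2 - (v' t)\<^sup>2 + 2 * (v t * a t) + 2 * ((v t + D t) * g t))"
  proof (rule set_lebesgue_integral_cong_AE)
    show "AE t\<in>{0..T} in lborel. (d t)\<^sup>2 =
        (a t)\<^sup>2 + (w t)\<^sup>2 + (v t)\<^sup>2 - (v' t)\<^sup>2 + 2 * (v t * a t) + 2 * ((v t + D t) * g t)"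
      using dyn'
    proof eventually_elim
      case (elim t)
      show ?case
      proof
        assume "t \<in> {0..T}"
        with elim have "d t = a t + D t + 2 * v t" by simp
        then show "(d t)\<^sup>2 =
            (a t)\<^sup>2 + (w t)\<^sup>2 + (v t)\<^sup>2 - (v' t)\<^sup>2 + 2 * (v t * a t) + 2 * ((v t + D t) * g t)"
          by (simp add: w_def g_def power2_eq_square algebra_simps)
      qed
    qed
  qed (simp_all add: w_def g_def)
  also have "\<dots> = (LINT t:{0..T}|lborel. (a t)\<^sup>2) + (LINT t:{0..T}|lborel. (w t)\<^sup>2)
      + (LINT t:{0..T}|lborel. (v t)\<^sup>2) - (LINT t:{0..T}|lborel. (v' t)\<^sup>2)
      + (LINT t:{0..T}|lborel. 2 * (v t * a t)) + (LINT t:{0..T}|lborel. 2 * ((v t + D t) * g t))"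
    using a2 w2 v2 v'2 va vDg
    by (simp only: set_integral_add set_integral_diff)
  also have "(LINT t:{0..T}|lborel. 2 * (v t * a t)) = (v T)\<^sup>2"
    unfolding v_def by (rule power2_primitive[OF a, symmetric])
  also have "(LINT t:{0..T}|lborel. 2 * ((v t + D t) * g t)) = (v T + D T)\<^sup>2"
    using power2_primitive[OF g, of T] by simp
  finally have "(LINT t:{0..T}|lborel. (d t)\<^sup>2) = (LINT t:{0..T}|lborel. (a t)\<^sup>2)
      + (LINT t:{0..T}|lborel. (w t)\<^sup>2)
      + (LINT t:{0..T}|lborel. (v t)\<^sup>2) - (LINT t:{0..T}|lborel. (v' t)\<^sup>2)
      + (v T)\<^sup>2 + (v T + D T)\<^sup>2" .
  moreover have "(LINT t:{0..T}|lborel. (w t)\<^sup>2) \<ge> 0"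
    unfolding set_lebesgue_integral_def by (intro integral_nonneg_AE) auto
  ultimately show "(LINT t:{0..T}|lborel. (a t)\<^sup>2) + (LINT t:{0..T}|lborel. (primitive a t)\<^sup>2)
      \<le> (LINT t:{0..T}|lborel. (d t)\<^sup>2) + (LINT t:{0..T}|lborel. (primitive b t)\<^sup>2)"
    unfolding v_def[symmetric] v'_def[symmetric]
    using zero_le_power2[of "v T"] zero_le_power2[of "v T + D T"] by linarith
qed

lemma primitive_zero [simp]: "primitive (\<lambda>t. 0) = (\<lambda>t. 0)"
  by (simp add: fun_eq_iff primitive_def)

text \<open>The velocity terms telescope along the chain, and there is none to start with because the leader does
not move.\<close>
lemma chain_energy_bound:
  fixes a d :: "nat \<Rightarrow> real \<Rightarrow> real"
  assumes a: "\<And>i. i \<le> N \<Longrightarrow> locally_integrable (a i)"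
    and a0: "a 0 = (\<lambda>t. 0)"
    and d: "\<And>i. i \<in> {1..N} \<Longrightarrow> d i \<in> borel_measurable borel"
      "\<And>i. i \<in> {1..N} \<Longrightarrow> set_integrable lborel {0..T} (\<lambda>t. (d i t)\<^sup>2)"
    and dyn: "\<And>i. i \<in> {1..N} \<Longrightarrow> AE t in lborel. 0 \<le> t \<longrightarrow>
      a i t = d i t + (primitive (primitive (a (i - 1))) t - primitive (primitive (a i)) t
        - 2 * primitive (a i) t)"
  shows "(\<Sum>i=1..N. LINT t:{0..T}|lborel. (a i t)\<^sup>2) \<le> (\<Sum>i=1..N. LINT t:{0..T}|lborel. (d i t)\<^sup>2)"
proof -
  have "(\<Sum>i=1..n. LINT t:{0..T}|lborel. (a i t)\<^sup>2) + (LINT t:{0..T}|lborel. (primitive (a n) t)\<^sup>2)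
      \<le> (\<Sum>i=1..n. LINT t:{0..T}|lborel. (d i t)\<^sup>2)" if "n \<le> N" for n
    using that
  proof (induction n)
    case 0
    then show ?case by (simp add: a0)
  next
    case (Suc n)
    have "(LINT t:{0..T}|lborel. (a (Suc n) t)\<^sup>2) + (LINT t:{0..T}|lborel. (primitive (a (Suc n)) t)\<^sup>2)
      \<le> (LINT t:{0..T}|lborel. (d (Suc n) t)\<^sup>2) + (LINT t:{0..T}|lborel. (primitive (a n) t)\<^sup>2)"
      using Suc.prems a d dyn[of "Suc n"] by (intro vehicle_energy_balance(2)) auto
    with Suc show ?case by simp
  qed
  from this[OF order_refl]
  have "(\<Sum>i=1..N. LINT t:{0..T}|lborel. (a i t)\<^sup>2) + (LINT t:{0..T}|lborel. (primitive (a N) t)\<^sup>2)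
      \<le> (\<Sum>i=1..N. LINT t:{0..T}|lborel. (d i t)\<^sup>2)" .
  moreover have "(LINT t:{0..T}|lborel. (primitive (a N) t)\<^sup>2) \<ge> 0"
    unfolding set_lebesgue_integral_def by (intro integral_nonneg_AE) auto
  ultimately show ?thesis
    by linarith
qed

section \<open>From transfer functions to the equations of motion\<close>

text \<open>With unit gain the control input of vehicle \<open>i\<close> equals \<open>e i\<close>, so this is the deviation of its
acceleration from that of the undisturbed motion. The leader is separated because its acceleration is
\<open>d 0 = 0\<close>, whereas \<open>e 0\<close> is arbitrary.\<close>
definition acceleration ::
  "(nat \<Rightarrow> real \<Rightarrow> real) \<Rightarrow> (nat \<Rightarrow> real \<Rightarrow> real) \<Rightarrow> nat \<Rightarrow> real \<Rightarrow> real" where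
  "acceleration d e i = (if i = 0 then (\<lambda>t. 0) else (\<lambda>t. d i t + e i t))"

text \<open>Multiplying the \<open>i\<close>-th closed-loop equation by \<open>s\<^sup>2 + 1 + 2 * s\<close> and substituting \<open>a = d + e\<close>
turns it into \<open>s\<^sup>2 * e i = a (i - 1) - (1 + 2 * s) * a i\<close>. Divided by \<open>s\<^sup>2\<close>, it contains only
single and double integrations of the accelerations; this keeps the inverse of \<open>(s + 1)\<^sup>2\<close> and its
convolutions out of the argument.\<close>
lemma chain_response_time_domain:
  assumes resp: "chain_response (pd_controller 1 0) 2 N d e" and d0: "\<And>t. d 0 t = 0"
  shows "\<And>i. i \<le> N \<Longrightarrow> locally_integrable (acceleration d e i)"
    and "\<And>i. i \<in> {1..N} \<Longrightarrow> AE t in lborel. 0 \<le> t \<longrightarrow>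
      e i t = primitive (primitive (acceleration d e (i - 1))) t
        - primitive (primitive (acceleration d e i)) t - 2 * primitive (acceleration d e i) t"
proof -
  define a where "a = acceleration d e"
  from resp obtain \<sigma>\<^sub>0 where
    causal: "\<And>i. i \<in> {0..N} \<Longrightarrow> causal (d i)" "\<And>i. i \<in> {1..N} \<Longrightarrow> causal (e i)" and
    tr\<^sub>0: "\<And>i. i \<in> {0..N} \<Longrightarrow> laplace_transformable \<sigma>\<^sub>0 (d i)"
      "\<And>i. i \<in> {1..N} \<Longrightarrow> laplace_transformable \<sigma>\<^sub>0 (e i)" and
    eq1: "\<And>s. Re s > \<sigma>\<^sub>0 \<Longrightarrow> laplace (e 1) s = disturbance_tf (pd_controller 1 0) 2 s *
      (laplace (d 0) s - (1 + of_real 2 * s) * laplace (d 1) s)" and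
    eq2: "\<And>s i. Re s > \<sigma>\<^sub>0 \<Longrightarrow> i \<in> {2..N} \<Longrightarrow> laplace (e i) s =
      error_tf (pd_controller 1 0) 2 s * laplace (e (i - 1)) s +
      disturbance_tf (pd_controller 1 0) 2 s *
        (laplace (d (i - 1)) s - (1 + of_real 2 * s) * laplace (d i) s)"
    unfolding chain_response_def by blast
  \<comment> \<open>The closed-loop equations hold strictly to the right of \<open>\<sigma>\<^sub>0\<close>, and integrators need a positive abscissa.\<close>
  define \<sigma> where "\<sigma> = max (\<sigma>\<^sub>0 + 1) 1"
  have \<sigma>: "\<sigma> > \<sigma>\<^sub>0" "\<sigma> > 0" by (auto simp: \<sigma>_def)
  have tr: "laplace_transformable \<sigma> (d i)" if "i \<in> {0..N}" for i
    using laplace_transformable_mono[OF tr\<^sub>0(1)[OF that]] \<sigma> by simp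
  have tr_e: "laplace_transformable \<sigma> (e i)" if "i \<in> {1..N}" for i
    using laplace_transformable_mono[OF tr\<^sub>0(2)[OF that]] \<sigma> by simp
  have tr_a: "laplace_transformable \<sigma> (a i)" if "i \<le> N" for i
    using laplace_transformable_lincomb[OF tr tr_e, of i i 1] that
    by (cases "i = 0") (simp_all add: a_def acceleration_def laplace_transformable_def set_integrable_def)
  have meas_a: "a i \<in> borel_measurable borel" if "i \<le> N" for i
  proof (rule causal_transformable_measurable[OF tr_a[OF that]])
    show "causal (a i)"
      using causal(1)[of i] causal(2)[of i] that by (auto simp: causal_def a_def acceleration_def)
  qed
  have li: "locally_integrable (a i)" if "i \<le> N" for i
    using laplace_transformable_imp_locally_integrable[OF tr_a[OF that] meas_a[OF that]] .
  then show "\<And>i. i \<le> N \<Longrightarrow> locally_integrable (acceleration d e i)"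
    by (simp add: a_def)
  have tr_v: "laplace_transformable \<sigma> (primitive (a i))" if "i \<le> N" for i
    using laplace_primitive(1)[OF tr_a[OF that] meas_a[OF that], of "of_real \<sigma>"] \<sigma> by simp
  have meas_v: "primitive (a i) \<in> borel_measurable borel" if "i \<le> N" for i
    using meas_a[OF that] by (rule borel_measurable_primitive)
  have tr_p: "laplace_transformable \<sigma> (primitive (primitive (a i)))" if "i \<le> N" for i
    using laplace_primitive(1)[OF tr_v[OF that] meas_v[OF that], of "of_real \<sigma>"] \<sigma> by simp
  show "AE t in lborel. 0 \<le> t \<longrightarrow>
      e i t = primitive (primitive (acceleration d e (i - 1))) t
        - primitive (primitive (acceleration d e i)) t - 2 * primitive (acceleration d e i) t"
    if i: "i \<in> {1..N}" for i
  proof -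
    have le: "i \<le> N" "i - 1 \<le> N" using i by auto
    \<comment> \<open>The nested form makes the Laplace transform of \<open>r\<close> follow from three uses of linearity.\<close>
    define r where "r t = ((e i t + (- 1) * primitive (primitive (a (i - 1))) t)
        + 1 * primitive (primitive (a i)) t) + 2 * primitive (a i) t" for t
    have tr_r1: "laplace_transformable \<sigma> (\<lambda>t. e i t + (- 1) * primitive (primitive (a (i - 1))) t)"
      using tr_e[OF i] tr_p[OF le(2)] by (rule laplace_transformable_lincomb)
    have tr_r2: "laplace_transformable \<sigma> (\<lambda>t. (e i t + (- 1) * primitive (primitive (a (i - 1))) t)
        + 1 * primitive (primitive (a i)) t)"
      using tr_r1 tr_p[OF le(1)] by (rule laplace_transformable_lincomb)
    have "AE t in lborel. 0 \<le> t \<longrightarrow> r t = 0"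
    proof (rule laplace_zero_imp_AE_zero)
      show "laplace_transformable \<sigma> r"
        unfolding r_def using tr_r2 tr_v[OF le(1)] by (rule laplace_transformable_lincomb)
      fix s assume s: "Re s = \<sigma>"
      then have s': "\<sigma> \<le> Re s" "Re s > 0" "Re s > \<sigma>\<^sub>0" using \<sigma> by auto
      have [simp]: "s \<noteq> 0" using s' by auto
      have ne: "s\<^sup>2 + (1 + 2 * s) \<noteq> 0"
      proof
        assume "s\<^sup>2 + (1 + 2 * s) = 0"
        then have "(s + 1)\<^sup>2 = 0" by (simp add: power2_eq_square algebra_simps)
        then have "s = - 1" by (simp add: eq_neg_iff_add_eq_0)
        then show False using s' by simp
      qed
      have lap_v: "laplace (primitive (a j)) s = laplace (a j) s / s" if "j \<le> N" for j
        using laplace_primitive(2)[OF tr_a[OF that] meas_a[OF that] s'(1,2)] .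
      have lap_p: "laplace (primitive (primitive (a j))) s = laplace (a j) s / s\<^sup>2" if "j \<le> N" for j
        using laplace_primitive(2)[OF tr_v[OF that] meas_v[OF that] s'(1,2)] lap_v[OF that]
        by (simp add: power2_eq_square)
      have lap_a: "laplace (a j) s = laplace (d j) s + laplace (e j) s" if "j \<in> {1..N}" for j
        using laplace_lincomb[OF tr tr_e s'(1), of j j 1] that by (simp add: a_def acceleration_def)
      have lap_0: "laplace (a 0) s = 0" "laplace (d 0) s = 0"
        by (simp_all add: a_def acceleration_def laplace_def d0)
      have "laplace (e i) s = (laplace (a (i - 1)) s - (1 + 2 * s) * laplace (d i) s) / (s\<^sup>2 + (1 + 2 * s))"
      proof (cases "i = 1")
        case True
        then show ?thesis
          using eq1[OF s'(3)] by (simp add: disturbance_tf_def pd_controller_def lap_0)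
      next
        case False
        then have "i \<in> {2..N}" "i - 1 \<in> {1..N}" using i by auto
        then show ?thesis
          using eq2[OF s'(3)] lap_a[of "i - 1"]
          by (simp add: disturbance_tf_def error_tf_def pd_controller_def
              add_divide_distrib diff_divide_distrib)
      qed
      then have "(s\<^sup>2 + (1 + 2 * s)) * laplace (e i) s = laplace (a (i - 1)) s - (1 + 2 * s) * laplace (d i) s"
        using ne by simp
      then have "s\<^sup>2 * laplace (e i) s = laplace (a (i - 1)) s - (1 + 2 * s) * laplace (a i) s"
        using lap_a[OF i] by (simp add: algebra_simps)
      then have "laplace (e i) s = (laplace (a (i - 1)) s - (1 + 2 * s) * laplace (a i) s) / s\<^sup>2"
        by (simp add: nonzero_eq_divide_eq mult.commute)
      also have "\<dots> = laplace (a (i - 1)) s / s\<^sup>2 - laplace (a i) s / s\<^sup>2 - 2 * (laplace (a i) s / s)"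
        by (simp add: diff_divide_distrib add_divide_distrib ring_distribs power2_eq_square)
      finally have "laplace (e i) s =
        laplace (a (i - 1)) s / s\<^sup>2 - laplace (a i) s / s\<^sup>2 - 2 * (laplace (a i) s / s)" .
      then show "laplace r s = 0"
        unfolding r_def
        by (subst laplace_lincomb[OF tr_r2 tr_v[OF le(1)] s'(1)],
            subst laplace_lincomb[OF tr_r1 tr_p[OF le(1)] s'(1)],
            subst laplace_lincomb[OF tr_e[OF i] tr_p[OF le(2)] s'(1)])
           (simp add: lap_v[OF le(1)] lap_p[OF le(1)] lap_p[OF le(2)] del: One_nat_def)
    qed
    then show ?thesis
      by eventually_elim (auto simp: r_def a_def)
  qed
qed

section \<open>String stability\<close>
lemma square_integrable_if_bounded_truncations:
  assumes f: "causal f" "f \<in> borel_measurable borel"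
    and int: "\<And>T. set_integrable lborel {0..T} (\<lambda>t. (f t)\<^sup>2)"
    and bound: "\<And>T. (LINT t:{0..T}|lborel. (f t)\<^sup>2) \<le> B"
  shows "square_integrable f"
    and "(\<lambda>n. LINT t:{0..real n}|lborel. (f t)\<^sup>2) \<longlonglongrightarrow> (signal_norm f)\<^sup>2"
proof -
  have union: "(\<Union>n. {0..real n}) = {0..}"
    by (auto simp: real_arch_simple)
  have mono: "mono (\<lambda>n. {0..real n})"
    by (auto simp: mono_def)
  have "incseq (\<lambda>n. LINT t:{0..real n}|lborel. (f t)\<^sup>2)"
  proof (rule incseq_SucI)
    fix n
    show "(LINT t:{0..real n}|lborel. (f t)\<^sup>2) \<le> (LINT t:{0..real (Suc n)}|lborel. (f t)\<^sup>2)"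
      using int[of n] int[of "Suc n"] unfolding set_lebesgue_integral_def set_integrable_def
      by (intro integral_mono) (auto simp: indicator_def)
  qed
  then obtain L where "(\<lambda>n. LINT t:{0..real n}|lborel. (f t)\<^sup>2) \<longlonglongrightarrow> L"
    using incseq_convergent[of _ B] bound by metis
  then have half_line: "set_integrable lborel {0..} (\<lambda>t. (f t)\<^sup>2)"
    using pos_integrable_to_top[of "\<lambda>n. {0..real n}" lborel "\<lambda>t. (f t)\<^sup>2"] int mono
    by (simp add: union)
  have ind: "(\<lambda>t. indicat_real {0..} t *\<^sub>R (f t)\<^sup>2) = (\<lambda>t. \<bar>f t\<bar>\<^sup>2)"
    using f(1) by (auto simp: fun_eq_iff causal_def indicator_def not_le)
  show "square_integrable f"
    using half_line f(2) unfolding square_integrable_def set_integrable_def ind by simp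
  have "(\<lambda>n. LINT t:{0..real n}|lborel. (f t)\<^sup>2) \<longlonglongrightarrow> (LINT t:{0..}|lborel. (f t)\<^sup>2)"
    using set_integral_cont_up[of "\<lambda>n. {0..real n}" lborel "\<lambda>t. (f t)\<^sup>2"] half_line mono
    by (simp add: union)
  also have "(LINT t:{0..}|lborel. (f t)\<^sup>2) = (signal_norm f)\<^sup>2"
    unfolding set_lebesgue_integral_def ind signal_norm_def by simp
  finally show "(\<lambda>n. LINT t:{0..real n}|lborel. (f t)\<^sup>2) \<longlonglongrightarrow> (signal_norm f)\<^sup>2" .
qed

text \<open>The energy bound reads \<open>\<parallel>a\<parallel> \<le> \<parallel>d\<parallel>\<close> on every bounded horizon, and \<open>e = a - d\<close>; therefore
\<open>\<parallel>e\<parallel>\<^sup>2 \<le> 2 * \<parallel>a\<parallel>\<^sup>2 + 2 * \<parallel>d\<parallel>\<^sup>2 \<le> 4 * \<parallel>d\<parallel>\<^sup>2\<close>. Square integrability of \<open>e\<close> is not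
known beforehand, so the bound passes to the whole time axis by monotone convergence.\<close>
lemma chain_L2_gain:
  assumes resp: "chain_response (pd_controller 1 0) 2 N d e" and d0: "\<And>t. d 0 t = 0"
    and d: "\<And>i. i \<in> {0..N} \<Longrightarrow> square_integrable (d i)"
  shows "\<And>i. i \<in> {1..N} \<Longrightarrow> square_integrable (e i)"
    and "vector_norm {1..N} e \<le> 2 * vector_norm {0..N} d"
proof -
  define a where "a = acceleration d e"
  note time_domain = chain_response_time_domain[OF resp d0, folded a_def]
  have causal: "causal (e i)" if "i \<in> {1..N}" for i
    using resp that by (auto simp: chain_response_def)
  have e_eq: "e i = (\<lambda>t. a i t - d i t)" if "i \<in> {1..N}" for i
    using that by (auto simp: a_def acceleration_def)
  have d_meas: "d i \<in> borel_measurable borel" and d_int: "integrable lborel (\<lambda>t. (d i t)\<^sup>2)"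
    if "i \<in> {1..N}" for i
    using d[of i] that by (auto simp: square_integrable_def)
  have d_int_T: "set_integrable lborel {0..T} (\<lambda>t. (d i t)\<^sup>2)" if "i \<in> {1..N}" for i T
    unfolding set_integrable_def by (rule integrable_mult_indicator[OF _ d_int[OF that]]) simp
  have a_meas: "a i \<in> borel_measurable borel" if "i \<in> {1..N}" for i
    using time_domain(1)[of i] that by (simp add: locally_integrable_def)
  have e_meas: "e i \<in> borel_measurable borel" if "i \<in> {1..N}" for i
    using d_meas[OF that] a_meas[OF that] by (simp add: e_eq[OF that])
  have dyn: "AE t in lborel. 0 \<le> t \<longrightarrow>
      a i t = d i t + (primitive (primitive (a (i - 1))) t - primitive (primitive (a i)) t
        - 2 * primitive (a i) t)" if "i \<in> {1..N}" for i
    using time_domain(2)[OF that] by eventually_elim (auto simp: e_eq[OF that])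
  have a_int_T: "set_integrable lborel {0..T} (\<lambda>t. (a i t)\<^sup>2)" if "i \<in> {1..N}" for i T
    using that by (intro vehicle_energy_balance(1)[OF _ _ d_meas d_int_T dyn] time_domain(1)) auto
  have ad_int_T: "set_integrable lborel {0..T} (\<lambda>t. 2 * (a i t)\<^sup>2 + 2 * (d i t)\<^sup>2)" if "i \<in> {1..N}" for i T
    using a_int_T[OF that] d_int_T[OF that] by simp
  have e_le: "(e i t)\<^sup>2 \<le> 2 * (a i t)\<^sup>2 + 2 * (d i t)\<^sup>2" if "i \<in> {1..N}" for i t
    using zero_le_power2[of "a i t + d i t"] by (simp add: e_eq[OF that] power2_eq_square algebra_simps)
  have e_int_T: "set_integrable lborel {0..T} (\<lambda>t. (e i t)\<^sup>2)" if "i \<in> {1..N}" for i T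
    using ad_int_T[OF that]
  proof (rule set_integrable_bound)
    show "set_borel_measurable lborel {0..T} (\<lambda>t. (e i t)\<^sup>2)"
      using e_meas[OF that] by (simp add: set_borel_measurable_def)
    show "AE t in lborel. t \<in> {0..T} \<longrightarrow> norm ((e i t)\<^sup>2) \<le> norm (2 * (a i t)\<^sup>2 + 2 * (d i t)\<^sup>2)"
      using e_le[OF that] by auto
  qed
  define S where "S = (\<Sum>i=1..N. (signal_norm (d i))\<^sup>2)"
  have d_le: "(LINT t:{0..T}|lborel. (d i t)\<^sup>2) \<le> (signal_norm (d i))\<^sup>2" if "i \<in> {1..N}" for i T
  proof -
    have "(LINT t:{0..T}|lborel. (d i t)\<^sup>2) \<le> (LINT t|lborel. (d i t)\<^sup>2)"
      using d_int_T[OF that, of T] d_int[OF that]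
      unfolding set_lebesgue_integral_def set_integrable_def
      by (intro integral_mono) (auto simp: indicator_def)
    also have "\<dots> = (signal_norm (d i))\<^sup>2"
      by (simp add: signal_norm_def)
    finally show ?thesis .
  qed
  have e_sum_T: "(\<Sum>i=1..N. LINT t:{0..T}|lborel. (e i t)\<^sup>2) \<le> 4 * S" for T
  proof -
    have "(\<Sum>i=1..N. LINT t:{0..T}|lborel. (e i t)\<^sup>2)
        \<le> (\<Sum>i=1..N. LINT t:{0..T}|lborel. 2 * (a i t)\<^sup>2 + 2 * (d i t)\<^sup>2)"
      using e_int_T ad_int_T e_le by (intro sum_mono set_integral_mono) auto
    also have "\<dots> = 2 * (\<Sum>i=1..N. LINT t:{0..T}|lborel. (a i t)\<^sup>2)
        + 2 * (\<Sum>i=1..N. LINT t:{0..T}|lborel. (d i t)\<^sup>2)"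
      using a_int_T d_int_T by (simp add: sum.distrib sum_distrib_left)
    also have "\<dots> \<le> 4 * (\<Sum>i=1..N. LINT t:{0..T}|lborel. (d i t)\<^sup>2)"
      using chain_energy_bound[of N a d T] time_domain(1) d_meas d_int_T dyn
      by (auto simp: a_def acceleration_def)
    also have "\<dots> \<le> 4 * S"
      unfolding S_def using d_le by (intro mult_left_mono sum_mono) auto
    finally show ?thesis .
  qed
  have e_T: "(LINT t:{0..T}|lborel. (e i t)\<^sup>2) \<le> 4 * S" if "i \<in> {1..N}" for i T
  proof -
    have "(LINT t:{0..T}|lborel. (e i t)\<^sup>2) \<le> (\<Sum>i=1..N. LINT t:{0..T}|lborel. (e i t)\<^sup>2)"
      using that by (intro member_le_sum) (auto simp: set_lebesgue_integral_def)
    with e_sum_T[of T] show ?thesis by simp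
  qed
  show "square_integrable (e i)" if "i \<in> {1..N}" for i
    using square_integrable_if_bounded_truncations(1)[OF causal e_meas e_int_T e_T] that by blast
  have "(\<lambda>n. \<Sum>i=1..N. LINT t:{0..real n}|lborel. (e i t)\<^sup>2) \<longlonglongrightarrow> (\<Sum>i=1..N. (signal_norm (e i))\<^sup>2)"
    using square_integrable_if_bounded_truncations(2)[OF causal e_meas e_int_T e_T]
    by (intro tendsto_sum) blast
  then have "(\<Sum>i=1..N. (signal_norm (e i))\<^sup>2) \<le> 4 * S"
    by (rule LIMSEQ_le_const2) (use e_sum_T in blast)
  also have "\<dots> \<le> 4 * (\<Sum>i\<in>{0..N}. (signal_norm (d i))\<^sup>2)"
    unfolding S_def by (intro mult_left_mono sum_mono2) auto
  finally have "vector_norm {1..N} e \<le> sqrt (4 * (\<Sum>i\<in>{0..N}. (signal_norm (d i))\<^sup>2))"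
    unfolding vector_norm_def L2_set_def by (rule real_sqrt_le_mono)
  then show "vector_norm {1..N} e \<le> 2 * vector_norm {0..N} d"
    unfolding vector_norm_def L2_set_def by (simp add: real_sqrt_mult)
qed

lemma L2_string_stable_unit_gain:
  "L2_string_stable (pd_controller 1 0) 2 (\<lambda>d. \<forall>t. d 0 t = 0)"
  unfolding L2_string_stable_def
proof (intro allI impI)
  fix \<epsilon> :: real assume "\<epsilon> > 0"
  then show "\<exists>\<delta>>0. \<forall>N\<ge>1. \<forall>d e.
        (\<forall>t. d 0 t = 0) \<and> (\<forall>i\<in>{0..N}. square_integrable (d i)) \<and>
        chain_response (pd_controller 1 0) 2 N d e \<and> vector_norm {0..N} d < \<delta> \<longrightarrow>
        (\<forall>i\<in>{1..N}. square_integrable (e i)) \<and> vector_norm {1..N} e < \<epsilon>"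
    using chain_L2_gain by (intro exI[of _ "\<epsilon> / 2"]) fastforce
qed

lemma stabilizing_unit_gain: "stabilizing (pd_controller 1 0) 2"
  unfolding stabilizing_def
proof (intro allI impI)
  fix s :: complex assume "Re s \<ge> 0"
  have "s\<^sup>2 + (1 + 2 * s) = (s + 1)\<^sup>2"
    by (simp add: power2_eq_square algebra_simps)
  moreover have "s + 1 \<noteq> 0"
    using \<open>Re s \<ge> 0\<close> by (auto simp: complex_eq_iff)
  ultimately have ne: "s\<^sup>2 + (1 + 2 * s) \<noteq> 0" by simp
  have no_pole: "\<not> is_pole f s" if "isCont f s" for f :: "complex \<Rightarrow> complex"
    using that not_tendsto_and_filterlim_at_infinity[of "at s" f "f s"]
    unfolding is_pole_def isCont_def by auto
  show "\<not> is_pole (error_tf (pd_controller 1 0) 2) s \<and>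
      \<not> is_pole (disturbance_tf (pd_controller 1 0) 2) s \<and>
      \<not> is_pole (\<lambda>s. disturbance_tf (pd_controller 1 0) 2 s * (1 + of_real 2 * s)) s"
    unfolding error_tf_def[abs_def] disturbance_tf_def[abs_def] pd_controller_def
    using ne by (intro conjI no_pole continuous_intros) auto
qed

text \<open>For unit gain the headway function is \<open>sqrt (2 - \<omega>\<^sup>2)\<close>, with maximum \<open>sqrt 2 < 2\<close> at \<open>\<omega> = 0\<close>.\<close>
lemma exceeds_headway_bound_unit_gain: "exceeds_headway_bound (pd_controller 1 0) 2"
proof -
  have rad: "headway_radicand (pd_controller 1 0) \<omega> = 2 - \<omega>\<^sup>2"
    and fn: "headway_function (pd_controller 1 0) \<omega> = sqrt (2 - \<omega>\<^sup>2)" for \<omega>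
    by (simp_all add: headway_radicand_def headway_function_def K_R_def K_J_def pd_controller_def)
  have "sqrt 2 < sqrt (2\<^sup>2)" by (rule real_sqrt_less_mono) simp
  then show ?thesis
    unfolding exceeds_headway_bound_def rad fn is_arg_max_def
    by (intro exI[of _ 0]) (auto simp: not_less)
qed

theorem theorem1:
  shows "\<exists>(K :: complex \<Rightarrow> complex) (h :: real).
           (\<exists>a b :: real. K = pd_controller a b) \<and>
           K 0 \<noteq> 0 \<and>
           h \<ge> 0 \<and>
           stabilizing K h \<and>
           exceeds_headway_bound K h \<and>
           L2_string_stable K h (\<lambda>d. \<forall>t. d 0 t = 0)"
proof (rule exI[of _ "pd_controller 1 0"], rule exI[of _ "2 :: real"], intro conjI)
  show "\<exists>a b. pd_controller 1 0 = pd_controller a b" by blast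
  show "pd_controller 1 0 0 \<noteq> 0" by (simp add: pd_controller_def)
qed (simp_all add: stabilizing_unit_gain exceeds_headway_bound_unit_gain L2_string_stable_unit_gain)

end
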